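(* Consider two joint distributions $\mathbb{P}_0$ and $\mathbb{P}_1$ of $(\boldsymbol Y,\boldsymbol Z)\in\mathbb{R}^{d_Y}\times\mathbb{R}^{d_Z}$ such that the marginal distribution of $\boldsymbol Y$ is the same under $\mathbb{P}_0$ and $\mathbb{P}_1$, and the marginal distribution of $\boldsymbol Z$ is the same under $\mathbb{P}_0$ and $\mathbb{P}_1$; moreover, under $\mathbb{P}_1$ $\boldsymbol Y$ is almost surely a function of $\boldsymbol Z$, while under $\mathbb{P}_0$ $\boldsymbol Y$ is independent of $\boldsymbol Z$. Assume $\boldsymbol Y$ is not almost surely a constant. If $(\boldsymbol Y,\boldsymbol Z)$ follows the mixture distribution $(1-\eta)\mathbb{P}_0+\eta\mathbb{P}_1$ for some $\eta\in[0,1]$, then $T^{\mathrm{AC}}(\boldsymbol Y,\boldsymbol Z)=\eta^2$.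
   Context: For vectors, $\ge$ is meant entrywise. $\tilde\mu_{\boldsymbol Y}$ is the product of the one-dimensional marginal distributions of the coordinates of $\boldsymbol Y$, and $$T^{\mathrm{AC}}(\boldsymbol Y,\boldsymbol Z):=\frac{\int \mathrm{var}(\mathbb{P}(\boldsymbol Y\ge \boldsymbol y\mid \boldsymbol Z))\,d\tilde\mu_{\boldsymbol Y}(\boldsymbol y)}{\int \mathrm{var}(\mathbb{1}\{\boldsymbol Y\ge \boldsymbol y\})\,d\tilde\mu_{\boldsymbol Y}(\boldsymbol y)}.$$ *)

theory Defs
  imports "HOL-Probability.Probability"
begin

definition mixture :: "real \<Rightarrow> 'a measure \<Rightarrow> 'a measure \<Rightarrow> 'a measure" where
  "mixture \<eta> P Q = measure_of (space P) (sets P)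
     (\<lambda>A. ennreal (1 - \<eta>) * emeasure P A + ennreal \<eta> * emeasure Q A)"

lemma space_mixture [simp]: "space (mixture \<eta> P Q) = space P"
  by (simp add: mixture_def)

lemma sets_mixture [simp, measurable_cong]: "sets (mixture \<eta> P Q) = sets P"
  by (simp add: mixture_def)

lemma emeasure_mixture:
  assumes "sets P = sets Q" and A: "A \<in> sets P"
  shows "emeasure (mixture \<eta> P Q) A = ennreal (1 - \<eta>) * emeasure P A + ennreal \<eta> * emeasure Q A"
  unfolding mixture_def
proof (rule emeasure_measure_of_sigma)
  show "sigma_algebra (space P) (sets P)" by (rule sets.sigma_algebra_axioms)
  show "positive (sets P) (\<lambda>A. ennreal (1 - \<eta>) * emeasure P A + ennreal \<eta> * emeasure Q A)"
    by (simp add: positive_def)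
  show "countably_additive (sets P) (\<lambda>A. ennreal (1 - \<eta>) * emeasure P A + ennreal \<eta> * emeasure Q A)"
  proof (rule countably_additiveI)
    fix B :: "nat \<Rightarrow> 'a set"
    assume B: "range B \<subseteq> sets P" "disjoint_family B"
    have "range B \<subseteq> sets Q" using B(1) assms(1) by simp
    then show "(\<Sum>i. ennreal (1 - \<eta>) * emeasure P (B i) + ennreal \<eta> * emeasure Q (B i)) =
        ennreal (1 - \<eta>) * emeasure P (\<Union>i. B i) + ennreal \<eta> * emeasure Q (\<Union>i. B i)"
      using B by (simp add: suminf_add[symmetric] ennreal_suminf_cmult suminf_emeasure)
  qed
qed (rule A)

text \<open>\<open>PiM\<close> lives on functions
  \<open>'n \<Rightarrow> real\<close>, so it is transported to \<open>real ^ 'n\<close>.\<close>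

definition prod_marginals :: "'w measure \<Rightarrow> ('w \<Rightarrow> real ^ 'n) \<Rightarrow> (real ^ 'n) measure" where
  "prod_marginals M Y =
     distr (PiM UNIV (\<lambda>i. distr M borel (\<lambda>\<omega>. Y \<omega> $ i))) borel (\<lambda>f. \<chi> i. f i)"

text \<open>A version of \<open>P(Y \<ge> y | Z)\<close>: conditioning is on the \<open>\<sigma>\<close>-algebra generated by \<open>Z\<close>, and
  the library order on \<open>real ^ 'n\<close> is the entrywise one. The variance below does not depend on
  the version.\<close>

definition cond_prob_ge ::
    "'w measure \<Rightarrow> ('w \<Rightarrow> real ^ 'n) \<Rightarrow> ('w \<Rightarrow> real ^ 'm) \<Rightarrow> real ^ 'n \<Rightarrow> 'w \<Rightarrow> real" where
  "cond_prob_ge M Y Z y =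
     real_cond_exp M (vimage_algebra (space M) Z borel) (indicator {\<omega> \<in> space M. Y \<omega> \<ge> y})"

definition T_AC :: "'w measure \<Rightarrow> ('w \<Rightarrow> real ^ 'n) \<Rightarrow> ('w \<Rightarrow> real ^ 'm) \<Rightarrow> real" where
  "T_AC M Y Z =
     (\<integral>y. prob_space.variance M (cond_prob_ge M Y Z y) \<partial>prod_marginals M Y) /
     (\<integral>y. prob_space.variance M (indicator {\<omega> \<in> space M. Y \<omega> \<ge> y}) \<partial>prod_marginals M Y)"

end

theory Submission
  imports Defs
begin

text \<open>
  Fix a threshold \<open>y\<close> and put \<open>p = P(Y \<ge> y)\<close>, which is the same number under \<open>P0\<close>, \<open>P1\<close> and the
  mixture because the three laws share the marginal of \<open>Y\<close>. Under \<open>P1\<close> the event \<open>Y \<ge> y\<close> is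
  almost surely an event \<open>Z \<in> B\<close>; under \<open>P0\<close> it is independent of \<open>Z\<close>. Since the laws of \<open>Z\<close> also
  agree, testing against events \<open>Z \<in> C\<close> gives under the mixture
  \<open>P(Y \<ge> y | Z) = (1 - \<eta>) * p + \<eta> * 1{Z \<in> B}\<close> almost surely. The constant does not contribute to
  the variance, and \<open>Z \<in> B\<close> has probability \<open>p\<close>, so the variance is \<open>\<eta>\<^sup>2 * p * (1 - p)\<close>, that is
  \<open>\<eta>\<^sup>2\<close> times the variance of \<open>1{Y \<ge> y}\<close> (lemma \<open>variance_cond_prob_mixture\<close>). Hence the numerator
  of \<open>T_AC\<close> is \<open>\<eta>\<^sup>2\<close> times the denominator.

  Two points need work. The function expressing \<open>Y\<close> through \<open>Z\<close> is an arbitrary function, so that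
  the existence of a Borel set \<open>B\<close> is not immediate; lemma \<open>AE_borel_event_of_AE_function\<close>
  gets \<open>B\<close> as a countable union of projections of compact subsets of its graph. And the quotient equals
  \<open>\<eta>\<^sup>2\<close> only if the denominator is nonzero. There the integration is against the product of the
  marginals, which may be very different from the law of \<open>Y\<close>; lemma
  \<open>integral_survival_variance_pos\<close> exhibits a box of positive product measure on which
  \<open>0 < P(Y \<ge> y) < 1\<close>: one nondegenerate coordinate of \<open>y\<close> is kept in a central interval of its
  distribution and all others are kept in their lower tails.
\<close>

section \<open>Events of an almost sure function\<close>

text \<open>Inner regularity of finite Borel measures, in the form of a \<open>\<sigma>\<close>-compact subset of full measure.\<close>

lemma sigma_compact_exhaustion:
  fixes M :: "'a::{second_countable_topology, complete_space} measure"
  assumes sb: "sets M = sets borel" and fin: "emeasure M (space M) \<noteq> \<infinity>"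
    and B: "B \<in> sets borel"
  shows "\<exists>K :: nat \<Rightarrow> 'a set. (\<forall>n. compact (K n) \<and> K n \<subseteq> B) \<and> B - (\<Union>n. K n) \<in> null_sets M"
proof -
  interpret finite_measure M by (rule finite_measureI) (use fin in auto)
  have "\<exists>K. compact K \<and> K \<subseteq> B \<and> measure M B - 1 / real (Suc n) < measure M K" for n
  proof -
    show ?thesis
    proof (cases "emeasure M B = 0")
      case True
      then show ?thesis
        by (intro exI[of _ "{}"]) (simp add: measure_def)
    next
      case False
      then have "0 < measure M B"
        by (simp add: emeasure_eq_measure zero_less_measure_iff)
      then have "ennreal (measure M B - 1 / real (Suc n)) < ennreal (measure M B)"
        by (intro ennreal_lessI) simp_all
      also have "\<dots> = (SUP K \<in> {K. K \<subseteq> B \<and> compact K}. emeasure M K)"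
        using inner_regular[OF sb fin B] by (simp only: emeasure_eq_measure)
      finally have "ennreal (measure M B - 1 / real (Suc n)) < (SUP K \<in> {K. K \<subseteq> B \<and> compact K}. emeasure M K)" .
      then obtain K where K: "K \<subseteq> B" "compact K" "ennreal (measure M B - 1 / real (Suc n)) < emeasure M K"
        by (auto simp: less_SUP_iff)
      then have "measure M B - 1 / real (Suc n) < measure M K"
        by (metis emeasure_eq_measure ennreal_leI leD leI)
      with K show ?thesis by blast
    qed
  qed
  then obtain K where K: "compact (K n)" "K n \<subseteq> B" "measure M B - 1 / real (Suc n) < measure M (K n)" for n :: nat
    by metis
  have Kb: "K n \<in> sets M" for n
    using K(1)[of n] by (simp add: sb compact_imp_closed borel_closed)
  have Bs: "B \<in> sets M" using B sb by simp
  let ?U = "\<Union>n. K n"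
  have Us: "?U \<in> sets M" "?U \<subseteq> B" using Kb K(2) by auto
  have "measure M B - measure M ?U \<le> 1 / real (Suc n)" for n
  proof -
    have "measure M (K n) \<le> measure M ?U"
      by (rule finite_measure_mono) (use Us in auto)
    then show ?thesis using K(3)[of n] by linarith
  qed
  then have "measure M B - measure M ?U \<le> 0"
    by (intro LIMSEQ_le_const[OF LIMSEQ_inverse_real_of_nat]) (auto simp: inverse_eq_divide)
  then have "measure M (B - ?U) = 0"
    using finite_measure_Diff[OF Bs Us] measure_nonneg[of M "B - ?U"] by linarith
  then have "B - ?U \<in> null_sets M"
    using Bs Us by (auto simp: null_sets_def emeasure_eq_measure)
  then show ?thesis using K by blast
qed

text \<open>
  Coordinate projections of Borel sets need not be Borel, but those of compact sets are compact. So
  \<open>B\<close> is the projection of a \<open>\<sigma>\<close>-compact set that exhausts, up to a null set, the part of the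
  graph of \<open>f\<close> lying over \<open>S\<close>. No point of the graph outside that part is projected into \<open>B\<close>,
  because a graph has at most one point over each value of the second coordinate.
\<close>

lemma AE_borel_event_of_AE_function:
  fixes P :: "('a::{second_countable_topology, complete_space} \<times>
      'b::{second_countable_topology, complete_space}) measure"
  assumes sb: "sets P = sets borel" and fin: "emeasure P (space P) \<noteq> \<infinity>"
    and f: "AE p in P. fst p = f (snd p)" and S: "S \<in> sets borel"
  shows "\<exists>B\<in>sets borel. AE p in P. fst p \<in> S \<longleftrightarrow> snd p \<in> B"
proof -
  have sp: "space P = UNIV" using sb by (metis sets_eq_imp_space_eq space_borel)
  obtain N where N: "{p \<in> space P. fst p \<noteq> f (snd p)} \<subseteq> N" "N \<in> null_sets P"
    using f unfolding eventually_ae_filter by blast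
  \<comment> \<open>a Borel set of full measure contained in the graph of \<open>f\<close>\<close>
  define G where "G = - N"
  have G: "G \<in> sets borel" using null_setsD2[OF N(2)] sb by (simp add: G_def borel_comp)
  have graph: "fst p = f (snd p)" if "p \<in> G" for p
    using N(1) that by (auto simp: G_def sp)
  have "fst -` S \<in> sets (borel :: ('a \<times> 'b) measure)"
    using measurable_sets[OF borel_measurable_continuous_onI[OF continuous_on_fst[OF continuous_on_id]] S]
    by simp
  then have GS: "G \<inter> fst -` S \<in> sets borel" using G by auto
  obtain K :: "nat \<Rightarrow> ('a \<times> 'b) set" where
    K: "\<And>n. compact (K n)" "\<And>n. K n \<subseteq> G \<inter> fst -` S" and K0: "(G \<inter> fst -` S) - (\<Union>n. K n) \<in> null_sets P"
    using sigma_compact_exhaustion[OF sb fin GS] by blast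
  define B where "B = (\<Union>n. snd ` K n)"
  have "compact (snd ` K n)" for n
    by (intro compact_continuous_image K continuous_intros)
  then have "B \<in> sets borel"
    unfolding B_def by (intro sets.countable_UN) (auto intro!: borel_closed compact_imp_closed)
  moreover have "AE p in P. fst p \<in> S \<longleftrightarrow> snd p \<in> B"
    using AE_not_in[OF N(2)] AE_not_in[OF K0]
  proof eventually_elim
    case (elim p)
    then have pG: "p \<in> G" by (simp add: G_def)
    show ?case
    proof
      assume "fst p \<in> S"
      then have "p \<in> (\<Union>n. K n)" using elim pG by auto
      then show "snd p \<in> B" unfolding B_def by auto
    next
      assume "snd p \<in> B"
      then obtain n q where q: "q \<in> K n" "snd p = snd q" unfolding B_def by auto
      then have "q \<in> G" "fst q \<in> S" using K(2) by auto
      then show "fst p \<in> S" using graph[OF pG] graph[of q] q by simp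
    qed
  qed
  ultimately show ?thesis by blast
qed

section \<open>Quantiles of real distributions\<close>

context real_distribution
begin

lemma quantile_exists:
  assumes "0 < q" "q < 1"
  shows "\<exists>c. q \<le> measure M {..c} \<and> measure M {..<c} \<le> q"
proof -
  define T where "T = {t. q \<le> cdf M t}"
  have "eventually (\<lambda>t. q < cdf M t) at_top"
    using cdf_lim_at_top_prob assms(2) by (rule order_tendstoD(1))
  then obtain t1 where "q < cdf M t1" by (auto simp: eventually_at_top_linorder)
  then have ne: "T \<noteq> {}" unfolding T_def by (auto intro!: exI[of _ t1])
  have "eventually (\<lambda>t. cdf M t < q) at_bot"
    using cdf_lim_at_bot assms(1) by (rule order_tendstoD(2))
  then obtain t0 where t0: "\<And>t. t \<le> t0 \<Longrightarrow> cdf M t < q" by (auto simp: eventually_at_bot_linorder)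
  have bdd: "bdd_below T"
    by (rule bdd_belowI[of _ t0]) (metis T_def t0 mem_Collect_eq not_le nle_le)
  define c where "c = Inf T"
  have above: "q \<le> cdf M t" if "c < t" for t
  proof -
    obtain s where "s \<in> T" "s < t" using \<open>c < t\<close> ne bdd unfolding c_def by (auto simp: cInf_less_iff)
    then show ?thesis using cdf_nondecreasing[of s t] by (auto simp: T_def)
  qed
  have below: "cdf M t < q" if "t < c" for t
    using cInf_lower[OF _ bdd, of t] that unfolding c_def T_def by force
  have "(cdf M \<longlongrightarrow> cdf M c) (at_right c)"
    using cdf_is_right_cont[of c] by (simp add: continuous_within)
  then have "q \<le> cdf M c"
    by (rule tendsto_lowerbound) (auto simp: eventually_at_filter above)
  moreover have "measure M {..<c} \<le> q"
    by (rule tendsto_upperbound[OF cdf_at_left])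
      (auto simp: eventually_at_filter intro!: always_eventually less_imp_le below)
  ultimately show ?thesis by (auto simp: cdf_def2)
qed

lemma prob_atLeast_eq: "measure M {c..} = 1 - measure M {..<c}"
  using prob_compl[of "{..<c}"] by (simp add: Compl_eq_Diff_UNIV[symmetric])

text \<open>
  If every upper half-line had probability 0 or 1, all the mass would sit at a median \<open>m\<close>: the
  half-line \<open>{m..}\<close> would have probability 1, and each \<open>{m + 1/n..}\<close> probability 0.
\<close>

lemma nondegenerate_split_point:
  assumes nc: "\<not> (\<exists>c. AE x in M. x = c)"
  shows "\<exists>c. 0 < measure M {c..} \<and> measure M {c..} < 1"
proof (rule ccontr)
  assume "\<not> ?thesis"
  then have triv: "measure M {c..} = 0 \<or> measure M {c..} = 1" for c
    using measure_nonneg[of M "{c..}"] prob_le_1[of "{c..}"] by (metis less_le)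
  obtain m where m: "1/2 \<le> measure M {..m}" "measure M {..<m} \<le> 1/2"
    using quantile_exists[of "1/2"] by auto
  then have "measure M {m..} = 1" using triv[of m] prob_atLeast_eq[of m] by auto
  then have lower: "AE x in M. m \<le> x" by (subst (asm) prob_eq_1) auto
  have "AE x in M. \<not> m + 1 / real (Suc n) \<le> x" for n
  proof -
    have "measure M {..m} \<le> measure M {..<m + 1 / real (Suc n)}"
      by (rule finite_measure_mono) (auto intro: le_less_trans)
    then have "measure M {m + 1 / real (Suc n)..} = 0"
      using triv[of "m + 1 / real (Suc n)"] prob_atLeast_eq[of "m + 1 / real (Suc n)"] m(1) by auto
    then show ?thesis by (subst (asm) prob_eq_0) auto
  qed
  then have "AE x in M. \<forall>n. \<not> m + 1 / real (Suc n) \<le> x" by (simp add: AE_all_countable)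
  with lower have "AE x in M. x = m"
  proof eventually_elim
    case (elim x)
    show ?case
    proof (rule antisym)
      show "x \<le> m"
      proof (rule ccontr)
        assume "\<not> x \<le> m"
        then obtain n where "inverse (real (Suc n)) < x - m" using reals_Archimedean[of "x - m"] by auto
        then show False using elim(2) by (auto simp: inverse_eq_divide dest!: spec[of _ n])
      qed
    qed (use elim in auto)
  qed
  with nc show False by blast
qed

text \<open>
  The interval starts at a point \<open>a\<close> that splits the mass. If \<open>{a..}\<close> has mass \<open>s\<close>, then cutting off
  the top half of it, at the quantile \<open>b\<close> of level \<open>1 - s / 2\<close>, leaves positive mass on \<open>{a..b}\<close> and
  bounds the tails \<open>P(X \<ge> t)\<close> with \<open>t \<in> {a..b}\<close> away from both 0 and 1.
\<close>

lemma nondegenerate_central_interval: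
  assumes nc: "\<not> (\<exists>c. AE x in M. x = c)"
  shows "\<exists>\<epsilon> > 0. \<exists>a b. 0 < measure M {a..b} \<and> \<epsilon> \<le> measure M {b..} \<and> measure M {a..} < 1"
proof -
  obtain c where c: "0 < measure M {c..}" "measure M {c..} < 1"
    using nondegenerate_split_point[OF nc] by auto
  define e where "e = measure M {c..} / 2"
  obtain b where b: "1 - e \<le> measure M {..b}" "measure M {..<b} \<le> 1 - e"
    using quantile_exists[of "1 - e"] c by (auto simp: e_def)
  have "measure M {..b} \<le> measure M {..<c} + measure M {c..b}"
  proof -
    have "measure M {..b} \<le> measure M ({..<c} \<union> {c..b})" by (rule finite_measure_mono) auto
    also have "\<dots> \<le> measure M {..<c} + measure M {c..b}"
      by (rule measure_subadditive) auto
    finally show ?thesis .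
  qed
  then have "0 < measure M {c..b}" using b(1) c prob_atLeast_eq[of c] unfolding e_def by linarith
  moreover have "e \<le> measure M {b..}" using b(2) prob_atLeast_eq[of b] by simp
  moreover have "0 < e" using c by (simp add: e_def)
  ultimately show ?thesis using c(2) by blast
qed

end

section \<open>Positivity of the denominator\<close>

lemma borel_measurable_vec_nth [measurable]: "(\<lambda>y :: real ^ 'n. y $ i) \<in> borel_measurable borel"
  by (intro borel_measurable_continuous_onI continuous_intros)

lemma prob_space_prod_marginals_and_box:
  fixes Y :: "'w \<Rightarrow> real ^ 'n"
  assumes "prob_space M" and Y: "Y \<in> borel_measurable M"
  shows prob_space_prod_marginals: "prob_space (prod_marginals M Y)"
    and emeasure_prod_marginals_box: "(\<And>i. A i \<in> sets borel) \<Longrightarrow>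
      emeasure (prod_marginals M Y) {y. \<forall>i. y $ i \<in> A i}
        = (\<Prod>i\<in>UNIV. emeasure (distr M borel (\<lambda>\<omega>. Y \<omega> $ i)) (A i))"
proof -
  interpret prob_space M by fact
  have Yi: "(\<lambda>\<omega>. Y \<omega> $ i) \<in> borel_measurable M" for i
    using measurable_compose[OF Y borel_measurable_vec_nth] .
  define D where "D i = distr M borel (\<lambda>\<omega>. Y \<omega> $ i)" for i
  interpret D: prob_space "D i" for i
    unfolding D_def by (rule prob_space_distr[OF Yi])
  interpret D: product_prob_space D UNIV ..
  have vec[measurable]: "(\<lambda>f. \<chi> i. f i) \<in> measurable (PiM UNIV D) (borel :: (real ^ 'n) measure)"
  proof (subst borel_measurable_euclidean_space, rule ballI)
    fix b :: "real ^ 'n" assume "b \<in> Basis"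
    then obtain j where b: "b = axis j 1" by (auto simp: Basis_vec_def)
    have "(\<lambda>f. f j) \<in> measurable (PiM UNIV D) (D j)" by (rule measurable_component_singleton) simp
    then have "(\<lambda>f. f j) \<in> borel_measurable (PiM UNIV D)"
      by (simp add: D_def cong: measurable_cong_sets)
    then show "(\<lambda>f. (\<chi> i. f i) \<bullet> b) \<in> borel_measurable (PiM UNIV D)"
      by (simp add: b inner_axis)
  qed
  show "prob_space (prod_marginals M Y)"
    unfolding prod_marginals_def D_def[symmetric] by (intro D.prob_space_distr vec)
  assume A: "\<And>i. A i \<in> sets borel"
  have "{y :: real ^ 'n. \<forall>i. y $ i \<in> A i} = (\<Inter>i. (\<lambda>y. y $ i) -` A i)" by auto
  also have "\<dots> \<in> sets borel"
    using measurable_sets[OF borel_measurable_vec_nth A] by (intro sets.finite_INT) auto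
  finally have box: "{y :: real ^ 'n. \<forall>i. y $ i \<in> A i} \<in> sets borel" .
  have "emeasure (prod_marginals M Y) {y. \<forall>i. y $ i \<in> A i}
      = emeasure (PiM UNIV D) ((\<lambda>f. \<chi> i. f i) -` {y. \<forall>i. y $ i \<in> A i} \<inter> space (PiM UNIV D))"
    unfolding prod_marginals_def D_def[symmetric] by (rule emeasure_distr[OF vec box])
  also have "(\<lambda>f. \<chi> i. f i) -` {y. \<forall>i. y $ i \<in> A i} \<inter> space (PiM UNIV D) = Pi\<^sub>E UNIV A"
    by (auto simp: space_PiM D_def)
  also have "emeasure (PiM UNIV D) (Pi\<^sub>E UNIV A) = (\<Prod>i\<in>UNIV. emeasure (D i) (A i))"
    by (rule D.emeasure_PiM) (auto simp: A D_def)
  finally show "emeasure (prod_marginals M Y) {y. \<forall>i. y $ i \<in> A i}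
      = (\<Prod>i\<in>UNIV. emeasure (distr M borel (\<lambda>\<omega>. Y \<omega> $ i)) (A i))" by (simp add: D_def)
qed

lemma sets_prod_marginals [measurable_cong]: "sets (prod_marginals M Y) = sets borel"
  by (simp add: prod_marginals_def)

lemma pred_less_eq_vec_measurable:
  fixes X Y :: "'w \<Rightarrow> real ^ 'n"
  assumes [measurable]: "X \<in> borel_measurable M" "Y \<in> borel_measurable M"
  shows "Measurable.pred M (\<lambda>\<omega>. X \<omega> \<le> Y \<omega>)"
  unfolding less_eq_vec_def by measurable

lemma (in prob_space) survival_measurable:
  fixes Y :: "'a \<Rightarrow> real ^ 'n"
  assumes [measurable]: "Y \<in> borel_measurable M"
  shows "(\<lambda>y. prob {\<omega> \<in> space M. y \<le> Y \<omega>}) \<in> borel_measurable borel"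
proof -
  have "Measurable.pred (borel \<Otimes>\<^sub>M M) (\<lambda>(y, \<omega>). y \<le> Y \<omega>)"
    using pred_less_eq_vec_measurable[of fst "borel \<Otimes>\<^sub>M M" "\<lambda>p. Y (snd p)"] by (simp add: case_prod_beta)
  then have "{x \<in> space (borel \<Otimes>\<^sub>M M). case x of (y, \<omega>) \<Rightarrow> y \<le> Y \<omega>} \<in> sets (borel \<Otimes>\<^sub>M M)" by simp
  then have "(\<lambda>y. emeasure M (Pair y -` {x \<in> space (borel \<Otimes>\<^sub>M M). case x of (y, \<omega>) \<Rightarrow> y \<le> Y \<omega>})) \<in> borel_measurable borel"
    by (rule measurable_emeasure_Pair)
  moreover have "Pair y -` {x \<in> space (borel \<Otimes>\<^sub>M M). case x of (y, \<omega>) \<Rightarrow> y \<le> Y \<omega>} = {\<omega> \<in> space M. y \<le> Y \<omega>}" for y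
    by (auto simp: space_pair_measure)
  ultimately show ?thesis by (simp add: measure_def)
qed

text \<open>
  Let coordinate \<open>i\<close> be nondegenerate. The box \<open>Q\<close> restricts \<open>y $ i\<close> to a central interval \<open>{a..b}\<close>
  and every other \<open>y $ j\<close> to the lower tail \<open>{..c j}\<close> of level \<open>\<delta>\<close>. For \<open>y\<close> in the box,
  \<open>P(Y \<ge> y) \<le> P(Y $ i \<ge> a) < 1\<close>. By a union bound the event \<open>Y \<ge> y\<close> fails with probability at
  most \<open>(1 - \<epsilon>) + CARD('n) * \<delta>\<close>, and \<open>\<delta>\<close> is small enough to keep this below 1. The quantile
  property provides both \<open>P(Y $ j < c j) \<le> \<delta>\<close>, used in the union bound, and
  \<open>P(Y $ j \<le> c j) \<ge> \<delta>\<close>, which makes the product measure of the box positive.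
\<close>

lemma integral_survival_variance_pos:
  fixes Y :: "'w \<Rightarrow> real ^ 'n"
  assumes "prob_space M" and Y: "Y \<in> borel_measurable M"
    and nc: "\<not> (\<exists>c. AE \<omega> in M. Y \<omega> = c)"
  shows "0 < (\<integral>y. measure M {\<omega> \<in> space M. y \<le> Y \<omega>} * (1 - measure M {\<omega> \<in> space M. y \<le> Y \<omega>}) \<partial>prod_marginals M Y)"
    (is "0 < (\<integral>y. ?v y \<partial>?N)")
proof -
  interpret prob_space M by fact
  interpret N: prob_space "prod_marginals M Y" by (rule prob_space_prod_marginals) fact+
  note Y[measurable]
  define D where "D i = distr M borel (\<lambda>\<omega>. Y \<omega> $ i)" for i
  interpret D: real_distribution "D i" for i
    unfolding D_def by simp
  have D_measure: "measure (D j) A = prob {\<omega> \<in> space M. Y \<omega> $ j \<in> A}" if "A \<in> sets borel" for j A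
    unfolding D_def using that by (subst measure_distr) (auto intro!: arg_cong[where f=prob])
  have "\<exists>i. \<not> (\<exists>c. AE \<omega> in M. Y \<omega> $ i = c)"
  proof (rule ccontr)
    assume "\<not> ?thesis"
    then obtain c where "\<And>i. AE \<omega> in M. Y \<omega> $ i = c i" by metis
    then have "AE \<omega> in M. \<forall>i. Y \<omega> $ i = c i" by (simp add: AE_all_countable)
    then have "AE \<omega> in M. Y \<omega> = (\<chi> i. c i)" by (simp add: vec_eq_iff)
    with nc show False by blast
  qed
  then obtain i where "\<not> (\<exists>c. AE \<omega> in M. Y \<omega> $ i = c)" by blast
  then have "\<not> (\<exists>c. AE x in D i. x = c)"
    unfolding D_def by (subst AE_distr_iff) auto
  from D.nondegenerate_central_interval[OF this] obtain \<epsilon> a b where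
    e: "0 < \<epsilon>" and ab: "0 < measure (D i) {a..b}" "\<epsilon> \<le> measure (D i) {b..}" "measure (D i) {a..} < 1"
    by blast
  have e1: "\<epsilon> \<le> 1" using ab(2) D.prob_le_1[of i "{b..}"] by linarith
  define \<delta> where "\<delta> = \<epsilon> / (2 * CARD('n))"
  have "1 \<le> real CARD('n)"
    by (metis One_nat_def Suc_leI of_nat_1 of_nat_le_iff zero_less_card_finite)
  then have "\<epsilon> < 2 * real CARD('n)" using e1 by linarith
  then have d: "0 < \<delta>" "\<delta> < 1"
    using e by (auto simp: \<delta>_def)
  then have "\<forall>j. \<exists>c. \<delta> \<le> measure (D j) {..c} \<and> measure (D j) {..<c} \<le> \<delta>"
    using D.quantile_exists by blast
  then obtain c where c: "\<And>j. \<delta> \<le> measure (D j) {..c j}" "\<And>j. measure (D j) {..<c j} \<le> \<delta>"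
    by metis
  define Q where "Q j = (if j = i then {a..b} else {..c j})" for j
  let ?p = "\<lambda>y. prob {\<omega> \<in> space M. y \<le> Y \<omega>}"
  have "emeasure ?N {y. \<forall>j. y $ j \<in> Q j} = (\<Prod>j\<in>UNIV. emeasure (D j) (Q j))"
    unfolding D_def by (rule emeasure_prod_marginals_box[OF assms(1,2)]) (auto simp: Q_def)
  moreover have "emeasure (D j) (Q j) \<noteq> 0" for j
    using ab(1) c(1)[of j] d by (auto simp: Q_def D.emeasure_eq_measure)
  ultimately have box_pos: "emeasure ?N {y. \<forall>j. y $ j \<in> Q j} \<noteq> 0" by simp
  have box_v: "0 < ?v y" if y: "\<And>j. y $ j \<in> Q j" for y
  proof -
    have le_sets: "{\<omega> \<in> space M. y \<le> Y \<omega>} \<in> events"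
      using pred_less_eq_vec_measurable[of "\<lambda>_. y" M Y] by simp
    have "?p y \<le> prob {\<omega> \<in> space M. Y \<omega> $ i \<in> {a..}}"
      using y[of i] by (intro finite_measure_mono) (auto simp: Q_def less_eq_vec_def intro: order_trans)
    then have lt1: "?p y < 1" using ab(3) D_measure[of "{a..}" i] by simp
    define E where "E j = (if j = i then {\<omega> \<in> space M. Y \<omega> $ i \<in> {..<b}} else {\<omega> \<in> space M. Y \<omega> $ j \<in> {..<c j}})" for j
    have E: "E j \<in> events" for j by (auto simp: E_def)
    have "1 - ?p y = prob (space M - {\<omega> \<in> space M. y \<le> Y \<omega>})" by (rule prob_compl[symmetric, OF le_sets])
    also have "\<dots> \<le> prob (\<Union>j. E j)"
    proof (rule finite_measure_mono)
      show "space M - {\<omega> \<in> space M. y \<le> Y \<omega>} \<subseteq> (\<Union>j. E j)"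
      proof
        fix \<omega> assume w: "\<omega> \<in> space M - {\<omega> \<in> space M. y \<le> Y \<omega>}"
        then obtain j where "Y \<omega> $ j < y $ j" by (auto simp: less_eq_vec_def not_le)
        then have "\<omega> \<in> E j" using y[of j] w by (auto simp: E_def Q_def split: if_splits)
        then show "\<omega> \<in> (\<Union>j. E j)" by blast
      qed
    qed (use E in auto)
    also have "\<dots> \<le> (\<Sum>j\<in>UNIV. prob (E j))"
      using finite_measure_subadditive_finite[of UNIV E] E by auto
    also have "\<dots> \<le> (\<Sum>j\<in>UNIV. (if j = i then 1 - \<epsilon> else 0) + \<delta>)"
    proof (rule sum_mono)
      fix j
      show "prob (E j) \<le> (if j = i then 1 - \<epsilon> else 0) + \<delta>"
        using D_measure[of "{..<b}" i] D_measure[of "{..<c j}" j] D.prob_atLeast_eq[of i b] ab(2) c(2)[of j] d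
        by (auto simp: E_def)
    qed
    also have "\<dots> = 1 - \<epsilon> / 2"
      by (simp add: sum.distrib \<delta>_def)
    finally have "0 < ?p y" using e by linarith
    with lt1 show ?thesis by simp
  qed
  have v01: "0 \<le> ?v y" "?v y \<le> 1" for y
    using prob_le_1 by (auto intro!: mult_le_one)
  have meas[measurable]: "?v \<in> borel_measurable ?N"
    using survival_measurable[OF Y] by (simp cong: measurable_cong_sets add: sets_prod_marginals)
  have "integrable ?N ?v"
    by (rule N.integrable_const_bound[where B=1]) (use v01 in auto)
  moreover have "\<not> (AE y in ?N. ?v y = 0)"
  proof
    assume "AE y in ?N. ?v y = 0"
    then have "AE y in ?N. \<not> (\<forall>j. y $ j \<in> Q j)"
      by eventually_elim (use box_v in force)
    then have "emeasure ?N {y \<in> space ?N. \<not> \<not> (\<forall>j. y $ j \<in> Q j)} = 0"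
      by (intro iffD1[OF AE_iff_measurable[OF _ refl]]) (auto simp: Q_def)
    then show False using box_pos by (simp add: prod_marginals_def)
  qed
  ultimately have "(\<integral>y. ?v y \<partial>?N) \<noteq> 0"
    using v01(1) by (subst integral_nonneg_eq_0_iff_AE) auto
  moreover have "0 \<le> (\<integral>y. ?v y \<partial>?N)" by (rule integral_nonneg_AE) (use v01(1) in auto)
  ultimately show ?thesis by (simp only: less_le simp_thms not_sym)
qed

section \<open>Conditional probabilities under the mixture\<close>

lemma (in prob_space) variance_indicator:
  assumes "A \<in> events"
  shows "variance (indicator A :: 'a \<Rightarrow> real) = prob A * (1 - prob A)"
proof -
  have int: "integrable M (indicator A :: _ \<Rightarrow> real)"
    using assms by (intro integrable_real_indicator) (auto simp: emeasure_eq_measure)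
  have sq: "(indicator A \<omega> :: real)\<^sup>2 = indicator A \<omega>" for \<omega> by (simp add: indicator_def)
  have "variance (indicator A :: 'a \<Rightarrow> real) = expectation (indicator A) - (expectation (indicator A))\<^sup>2"
    using variance_eq[OF int] int by (simp add: sq)
  then show ?thesis using assms by (simp add: power2_eq_square algebra_simps)
qed

lemma (in prob_space) variance_AE_affine:
  assumes X: "AE \<omega> in M. X \<omega> = a + b * f \<omega>" "X \<in> borel_measurable M" and f: "integrable M f"
  shows "variance X = b\<^sup>2 * variance (f :: 'a \<Rightarrow> real)"
proof -
  note [measurable] = X(2) borel_measurable_integrable[OF f]
  have E: "expectation X = a + b * expectation f"
  proof -
    have "expectation X = expectation (\<lambda>\<omega>. a + b * f \<omega>)"
      by (rule integral_cong_AE) (use X(1) in auto)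
    also have "\<dots> = a + b * expectation f" using f by (simp add: prob_space)
    finally show ?thesis .
  qed
  have "variance X = expectation (\<lambda>\<omega>. b\<^sup>2 * (f \<omega> - expectation f)\<^sup>2)"
  proof (rule integral_cong_AE)
    show "AE \<omega> in M. (X \<omega> - expectation X)\<^sup>2 = b\<^sup>2 * (f \<omega> - expectation f)\<^sup>2"
      using X(1) by eventually_elim (simp add: E right_diff_distrib[symmetric] power_mult_distrib)
  qed auto
  then show ?thesis by simp
qed

lemma measure_mixture:
  assumes "finite_measure P" "finite_measure Q" "sets P = sets Q" "A \<in> sets P" "0 \<le> \<eta>" "\<eta> \<le> 1"
  shows "measure (mixture \<eta> P Q) A = (1 - \<eta>) * measure P A + \<eta> * measure Q A"
proof -
  interpret P: finite_measure P by fact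
  interpret Q: finite_measure Q by fact
  have "emeasure (mixture \<eta> P Q) A
      = ennreal (1 - \<eta>) * ennreal (measure P A) + ennreal \<eta> * ennreal (measure Q A)"
    unfolding emeasure_mixture[OF assms(3,4)] P.emeasure_eq_measure Q.emeasure_eq_measure ..
  also have "\<dots> = ennreal ((1 - \<eta>) * measure P A + \<eta> * measure Q A)"
    using assms(5,6) by (subst ennreal_plus) (auto simp only: ennreal_mult' intro!: mult_nonneg_nonneg measure_nonneg)
  finally show ?thesis
    using assms(5,6) by (simp add: measure_def[of "mixture \<eta> P Q"] del: ennreal_plus)
qed

text \<open>
  The hypothesis \<open>joint\<close> is the defining equation of the conditional probability of \<open>E\<close> given \<open>Z\<close>
  for the candidate \<open>a + b * 1{Z \<in> B}\<close>, integrated over the events \<open>Z \<in> C\<close>; these are all the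
  members of the \<open>\<sigma>\<close>-algebra generated by \<open>Z\<close>.
\<close>

lemma (in prob_space) cond_exp_indicator_mixture:
  fixes Z :: "'a \<Rightarrow> 'b::topological_space"
  assumes Z: "Z \<in> borel_measurable M" and E: "E \<in> events" and B: "B \<in> sets borel"
    and joint: "\<And>C. C \<in> sets borel \<Longrightarrow> prob (E \<inter> (Z -` C \<inter> space M))
      = a * prob (Z -` C \<inter> space M) + b * prob (Z -` (B \<inter> C) \<inter> space M)"
  shows "AE \<omega> in M. real_cond_exp M (vimage_algebra (space M) Z borel) (indicator E) \<omega>
           = a + b * indicator (Z -` B \<inter> space M) \<omega>"
proof -
  let ?F = "vimage_algebra (space M) Z borel"
  have "Z \<in> space M \<rightarrow> space borel" by simp
  note F_sets = sets_vimage_algebra2[OF this]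
  have sub: "subalgebra M ?F"
    unfolding subalgebra_def using measurable_sets[OF Z] by (auto simp: F_sets)
  interpret finite_measure_subalgebra M ?F by standard (rule sub)
  note finite_measure_subalgebra_is_sigma_finite[OF finite_measure_subalgebra_axioms]
  then interpret S: sigma_finite_subalgebra M ?F .
  have ZB: "Z -` B \<inter> space M \<in> events" using Z B by (rule measurable_sets)
  show ?thesis
  proof (rule real_cond_exp_charact)
    fix A assume "A \<in> sets ?F"
    then obtain C where C: "C \<in> sets borel" "A = Z -` C \<inter> space M" by (auto simp: F_sets)
    have A: "A \<in> events" unfolding C(2) using Z C(1) by (rule measurable_sets)
    have "(\<integral>x\<in>A. indicator E x \<partial>M) = prob (E \<inter> A)"
      using A E by (simp add: set_lebesgue_integral_def indicator_inter_arith[symmetric] Int_commute)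
    also have "\<dots> = a * prob A + b * prob (A \<inter> (Z -` B \<inter> space M))"
      unfolding C(2) joint[OF C(1)] by (auto intro!: arg_cong[where f=prob])
    also have "\<dots> = (\<integral>x. a * indicator A x + b * indicator (A \<inter> (Z -` B \<inter> space M)) x \<partial>M)"
      using A ZB by (subst Bochner_Integration.integral_add) (auto simp: less_top[symmetric])
    also have "\<dots> = (\<integral>x\<in>A. a + b * indicator (Z -` B \<inter> space M) x \<partial>M)"
      unfolding set_lebesgue_integral_def
      by (rule Bochner_Integration.integral_cong) (auto simp: indicator_def)
    finally show "(\<integral>x\<in>A. indicator E x \<partial>M) = (\<integral>x\<in>A. a + b * indicator (Z -` B \<inter> space M) x \<partial>M)" .
  next
    have "Z -` B \<inter> space M \<in> sets ?F" using B by (auto simp: F_sets)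
    then show "(\<lambda>\<omega>. a + b * indicator (Z -` B \<inter> space M) \<omega>) \<in> borel_measurable ?F" by measurable
  qed (use E ZB in \<open>auto simp: less_top[symmetric]\<close>)
qed

text \<open>
  Here \<open>joint\<close> holds with \<open>a = (1 - \<eta>) * P(Y \<ge> y)\<close> and \<open>b = \<eta>\<close>: independence factors the
  contribution of \<open>P0\<close>, and under \<open>P1\<close> the event \<open>Y \<ge> y\<close> may be replaced by \<open>Z \<in> B\<close>. The equality of
  the marginals lets all probabilities involving \<open>Y\<close> alone or \<open>Z\<close> alone be taken under \<open>M\<close>.
\<close>

lemma variance_cond_prob_mixture:
  fixes P0 P1 :: "((real ^ 'dY) \<times> (real ^ 'dZ)) measure"
    and Y :: "'w \<Rightarrow> real ^ 'dY" and Z :: "'w \<Rightarrow> real ^ 'dZ"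
  assumes "prob_space P0" and s0: "sets P0 = sets borel"
    and "prob_space P1" and s1: "sets P1 = sets borel"
    and same_Y: "distr P0 borel fst = distr P1 borel fst"
    and same_Z: "distr P0 borel snd = distr P1 borel snd"
    and Y_fun_of_Z: "\<exists>f. AE p in P1. fst p = f (snd p)"
    and Y_indep_Z: "prob_space.indep_set P0
      (sets (vimage_algebra (space P0) fst borel)) (sets (vimage_algebra (space P0) snd borel))"
    and eta: "0 \<le> \<eta>" "\<eta> \<le> 1"
    and "prob_space M"
    and Y: "Y \<in> borel_measurable M" and Z: "Z \<in> borel_measurable M"
    and law: "distr M borel (\<lambda>\<omega>. (Y \<omega>, Z \<omega>)) = mixture \<eta> P0 P1"
  shows "prob_space.variance M (cond_prob_ge M Y Z y)
    = \<eta>\<^sup>2 * (measure M {\<omega> \<in> space M. y \<le> Y \<omega>} * (1 - measure M {\<omega> \<in> space M. y \<le> Y \<omega>}))"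
proof -
  interpret M: prob_space M by fact
  interpret P0: prob_space P0 by fact
  interpret P1: prob_space P1 by fact
  have sp: "space P0 = UNIV" "space P1 = UNIV"
    using sets_eq_imp_space_eq[OF s0] sets_eq_imp_space_eq[OF s1] by simp_all
  have fst_b: "(fst :: (real ^ 'dY) \<times> (real ^ 'dZ) \<Rightarrow> _) \<in> borel_measurable borel"
    and snd_b: "(snd :: (real ^ 'dY) \<times> (real ^ 'dZ) \<Rightarrow> _) \<in> borel_measurable borel"
    by (intro borel_measurable_continuous_onI continuous_intros)+
  have [measurable]: "fst \<in> borel_measurable P0" "snd \<in> borel_measurable P0"
      "fst \<in> borel_measurable P1" "snd \<in> borel_measurable P1"
    using fst_b snd_b by (simp_all add: measurable_cong_sets[OF s0 refl] measurable_cong_sets[OF s1 refl])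
  have YZ: "(\<lambda>\<omega>. (Y \<omega>, Z \<omega>)) \<in> borel_measurable M"
    using Y Z by (rule borel_measurable_Pair)
  define S where "S = {y ..}"
  have S: "S \<in> sets borel" by (simp add: S_def)
  obtain f where "AE p in P1. fst p = f (snd p)" using Y_fun_of_Z by blast
  from AE_borel_event_of_AE_function[OF s1 _ this S] obtain B where
    B: "B \<in> sets borel" "AE p in P1. fst p \<in> S \<longleftrightarrow> snd p \<in> B" by auto
  define E where "E = {\<omega> \<in> space M. y \<le> Y \<omega>}"
  have E: "E = Y -` S \<inter> space M" by (auto simp: E_def S_def)
  have E_ev: "E \<in> M.events" unfolding E using Y S by (rule measurable_sets)
  have mix: "M.prob ((\<lambda>\<omega>. (Y \<omega>, Z \<omega>)) -` A \<inter> space M) = (1 - \<eta>) * P0.prob A + \<eta> * P1.prob A"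
    if "A \<in> sets borel" for A
  proof -
    have "M.prob ((\<lambda>\<omega>. (Y \<omega>, Z \<omega>)) -` A \<inter> space M) = measure (distr M borel (\<lambda>\<omega>. (Y \<omega>, Z \<omega>))) A"
      by (rule measure_distr[symmetric, OF YZ that])
    also have "\<dots> = (1 - \<eta>) * P0.prob A + \<eta> * P1.prob A"
      unfolding law by (rule measure_mixture) (use eta s0 s1 that P0.finite_measure_axioms P1.finite_measure_axioms in auto)
    finally show ?thesis .
  qed
  have snd_sets: "snd -` C \<in> sets (borel :: ((real ^ 'dY) \<times> (real ^ 'dZ)) measure)" if "C \<in> sets borel" for C
    using measurable_sets[OF snd_b that] by simp
  have fst_sets: "fst -` C \<in> sets (borel :: ((real ^ 'dY) \<times> (real ^ 'dZ)) measure)" if "C \<in> sets borel" for C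
    using measurable_sets[OF fst_b that] by simp
  have P01_Z: "P0.prob (snd -` C) = P1.prob (snd -` C)" if "C \<in> sets borel" for C
    using arg_cong[OF same_Z, of "\<lambda>D. measure D C"] that by (simp add: measure_distr sp)
  have P01_Y: "P0.prob (fst -` C) = P1.prob (fst -` C)" if "C \<in> sets borel" for C
    using arg_cong[OF same_Y, of "\<lambda>D. measure D C"] that by (simp add: measure_distr sp)
  have M_Z: "M.prob (Z -` C \<inter> space M) = P1.prob (snd -` C)" if "C \<in> sets borel" for C
    using mix[OF snd_sets[OF that]] P01_Z[OF that] by (simp add: vimage_def algebra_simps)
  have M_E: "M.prob E = P1.prob (fst -` S)"
    using mix[OF fst_sets[OF S]] P01_Y[OF S] by (simp add: E vimage_def algebra_simps)
  have prob_B: "P1.prob (snd -` B) = M.prob E"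
    unfolding M_E using B(2) fst_sets[OF S] snd_sets[OF B(1)] s1
    by (intro P1.finite_measure_eq_AE) auto
  have joint: "M.prob (E \<inter> (Z -` C \<inter> space M))
      = ((1 - \<eta>) * M.prob E) * M.prob (Z -` C \<inter> space M) + \<eta> * M.prob (Z -` (B \<inter> C) \<inter> space M)"
    if C: "C \<in> sets borel" for C
  proof -
    have "E \<inter> (Z -` C \<inter> space M) = (\<lambda>\<omega>. (Y \<omega>, Z \<omega>)) -` (fst -` S \<inter> snd -` C) \<inter> space M"
      by (auto simp: E)
    then have "M.prob (E \<inter> (Z -` C \<inter> space M))
        = (1 - \<eta>) * P0.prob (fst -` S \<inter> snd -` C) + \<eta> * P1.prob (fst -` S \<inter> snd -` C)"
      using mix[of "fst -` S \<inter> snd -` C"] fst_sets[OF S] snd_sets[OF C] by simp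
    also have "P0.prob (fst -` S \<inter> snd -` C) = P0.prob (fst -` S) * P0.prob (snd -` C)"
      using P0.indep_setD[OF Y_indep_Z] in_vimage_algebra[OF S, of fst "space P0"] in_vimage_algebra[OF C, of snd "space P0"]
      by (simp add: sp)
    also have "P1.prob (fst -` S \<inter> snd -` C) = P1.prob (snd -` (B \<inter> C))"
    proof (rule P1.finite_measure_eq_AE)
      show "AE p in P1. p \<in> fst -` S \<inter> snd -` C \<longleftrightarrow> p \<in> snd -` (B \<inter> C)"
        using B(2) by eventually_elim auto
    qed (use fst_sets[OF S] snd_sets[OF C] snd_sets[of "B \<inter> C"] B(1) C s1 in auto)
    finally show ?thesis
      using M_Z[OF C] M_Z[of "B \<inter> C"] M_E P01_Z[OF C] P01_Y[OF S] B(1) C by simp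
  qed
  let ?ZB = "Z -` B \<inter> space M"
  have ZB: "?ZB \<in> M.events" using Z B(1) by (rule measurable_sets)
  have "AE \<omega> in M. cond_prob_ge M Y Z y \<omega> = (1 - \<eta>) * M.prob E + \<eta> * indicator ?ZB \<omega>"
    unfolding cond_prob_ge_def E_def[symmetric]
    by (rule M.cond_exp_indicator_mixture[OF Z E_ev B(1) joint])
  then have "M.variance (cond_prob_ge M Y Z y) = \<eta>\<^sup>2 * M.variance (indicator ?ZB)"
    by (rule M.variance_AE_affine) (use ZB in \<open>auto simp: cond_prob_ge_def less_top[symmetric]\<close>)
  also have "M.variance (indicator ?ZB) = M.prob E * (1 - M.prob E)"
    using M.variance_indicator[OF ZB] M_Z[OF B(1)] prob_B by simp
  finally show ?thesis unfolding E_def .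
qed

theorem proposition3:
  fixes P0 P1 :: "((real ^ 'dY) \<times> (real ^ 'dZ)) measure"
    and M :: "'w measure"
    and Y :: "'w \<Rightarrow> real ^ 'dY" and Z :: "'w \<Rightarrow> real ^ 'dZ"
    and \<eta> :: real
  assumes "prob_space P0" and "sets P0 = sets borel"
    and "prob_space P1" and "sets P1 = sets borel"
    and same_Y: "distr P0 borel fst = distr P1 borel fst"
    and same_Z: "distr P0 borel snd = distr P1 borel snd"
    and Y_fun_of_Z: "\<exists>f. AE p in P1. fst p = f (snd p)"
    and Y_indep_Z: "prob_space.indep_set P0
      (sets (vimage_algebra (space P0) fst borel)) (sets (vimage_algebra (space P0) snd borel))"
    and nonconst: "\<not> (\<exists>c. AE p in P0. fst p = c)"
    and "0 \<le> \<eta>" and "\<eta> \<le> 1"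
    and "prob_space M"
    and "Y \<in> borel_measurable M" and "Z \<in> borel_measurable M"
    and law: "distr M borel (\<lambda>\<omega>. (Y \<omega>, Z \<omega>)) = mixture \<eta> P0 P1"
  shows "T_AC M Y Z = \<eta>\<^sup>2"
proof -
  interpret M: prob_space M by fact
  interpret P0: prob_space P0 by fact
  interpret P1: prob_space P1 by fact
  have sp: "space P0 = UNIV" "space P1 = UNIV"
    using sets_eq_imp_space_eq[OF assms(2)] sets_eq_imp_space_eq[OF assms(4)] by simp_all
  have fst_b: "(fst :: (real ^ 'dY) \<times> (real ^ 'dZ) \<Rightarrow> _) \<in> borel_measurable borel"
    by (intro borel_measurable_continuous_onI continuous_intros)
  then have fst_m: "fst \<in> borel_measurable P0" "fst \<in> borel_measurable P1"
    using assms(2,4) by (simp_all cong: measurable_cong_sets)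
  let ?v = "\<lambda>y. measure M {\<omega> \<in> space M. y \<le> Y \<omega>} * (1 - measure M {\<omega> \<in> space M. y \<le> Y \<omega>})"
  \<comment> \<open>nondegeneracy passes from \<open>P0\<close> to \<open>M\<close>, as \<open>Y\<close> has the same law under both\<close>
  have "\<not> (\<exists>c. AE \<omega> in M. Y \<omega> = c)"
  proof
    assume "\<exists>c. AE \<omega> in M. Y \<omega> = c"
    then obtain c where c: "AE \<omega> in M. Y \<omega> = c" by blast
    let ?A = "fst -` {c} :: ((real ^ 'dY) \<times> (real ^ 'dZ)) set"
    have A: "?A \<in> sets borel" using measurable_sets[OF fst_b, of "{c}"] by simp
    have "P0.prob ?A = P1.prob ?A"
      using arg_cong[OF same_Y, of "\<lambda>D. measure D {c}"] fst_m by (simp add: measure_distr sp)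
    then have "P0.prob ?A = (1 - \<eta>) * P0.prob ?A + \<eta> * P1.prob ?A" by (simp add: algebra_simps)
    also have "\<dots> = measure (mixture \<eta> P0 P1) ?A"
      by (rule measure_mixture[symmetric])
        (use assms A P0.finite_measure_axioms P1.finite_measure_axioms in auto)
    also have "\<dots> = M.prob ((\<lambda>\<omega>. (Y \<omega>, Z \<omega>)) -` ?A \<inter> space M)"
      unfolding law[symmetric] by (rule measure_distr[OF borel_measurable_Pair A]) fact+
    also have "\<dots> = 1"
      by (subst M.prob_eq_1) (use c assms(13) in \<open>auto simp: vimage_def\<close>)
    finally have "AE p in P0. p \<in> ?A" using P0.prob_eq_1[of ?A] A assms(2) by simp
    then show False using nonconst by auto
  qed
  then have pos: "0 < (\<integral>y. ?v y \<partial>prod_marginals M Y)"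
    by (rule integral_survival_variance_pos[OF assms(12,13)])
  have "prob_space.variance M (indicator {\<omega> \<in> space M. y \<le> Y \<omega>}) = ?v y" for y
    using pred_less_eq_vec_measurable[of "\<lambda>_. y" M Y] assms(13) by (intro M.variance_indicator) simp
  moreover have "prob_space.variance M (cond_prob_ge M Y Z y) = \<eta>\<^sup>2 * ?v y" for y
    by (rule variance_cond_prob_mixture[OF assms(1-8) assms(10-15)])
  ultimately show ?thesis
    unfolding T_AC_def using pos by simp
qed

end
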